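(* Let $m$ be a positive integer. With the distributions $\partial_r^{2k}\delta$, $(\underline{\omega}\,\partial_r^{2k+1})\delta$ in $\mathbb{R}^m$, the signumdistributions $\underline{\omega}\,\partial_r^{2k}\delta$, $\partial_r^{2k+1}\delta$, and the actions of $r$ and $\partial_r$ as defined in the context, the following equalities of signumdistributions hold: $$r\,(\underline{\omega}\,\partial_r^{2k+1})\,\delta(\underline{x}) = -(m+2k)\,\underline{\omega}\,\partial_r^{2k}\,\delta(\underline{x}),\qquad k\ge 0,$$ $$r\,\partial_r^{2k}\,\delta(\underline{x}) = -(m+2k-1)\,\partial_r^{2k-1}\,\delta(\underline{x}),\qquad k\ge 1,$$ $$\partial_r\,(\underline{\omega}\,\partial_r^{2k+1})\,\delta(\underline{x}) = \underline{\omega}\,\partial_r^{2k+2}\,\delta(\underline{x}),\qquad k\ge 0,$$ $$\partial_r\,\partial_r^{2k}\,\delta(\underline{x}) = \partial_r^{2k+1}\,\delta(\underline{x}),\qquad k\ge 0.$$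
   Context: Let $\mathbb{R}_{0,m}$ be the real Clifford algebra generated by $e_1,\dots,e_m$ with $e_j^2=-1$ and $e_ie_j=-e_je_i$ for $i\neq j$. Put $\underline{x}=\sum_{j=1}^m e_jx_j$, $r=|\underline{x}|$, $\underline{\omega}=\underline{x}/|\underline{x}|$ (so $\underline{x}=r\underline{\omega}$, $\underline{\omega}^2=-1$), and let $\underline{\partial}=\sum_{j=1}^m e_j\partial_{x_j}$ be the Dirac operator. Distributions are $\mathbb{R}_{0,m}$-valued continuous linear functionals on the space $\mathcal{D}(\mathbb{R}^m)$ of real-valued test functions; $\underline{x}$ and $\underline{\partial}$ act from the left in the usual way, so $\langle\underline{\partial}\,\delta,\varphi\rangle=-(\underline{\partial}\varphi)(0)$. Signumdistributions. Let $\Omega(\mathbb{R}^m)=\{\underline{\omega}\,\varphi : \varphi\in\mathcal{D}(\mathbb{R}^m)\}$, with the topology transported from $\mathcal{D}(\mathbb{R}^m)$ by the bijection $\varphi\leftrightarrow\underline{\omega}\varphi$. A signumdistribution is a continuous linear ($\mathbb{R}_{0,m}$-valued) functional on $\Omega(\mathbb{R}^m)$. The distributions. For $k\ge 0$, with empty products equal to $1$, $$\partial_r^{2k}\delta=\frac{(-1)^k}{2^kk!}(m+1)(m+3)\cdots(m+2k-1)\,\underline{\partial}^{2k}\delta,\qquad (\underline{\omega}\,\partial_r^{2k+1})\delta=\frac{(-1)^k}{2^kk!}(m+1)(m+3)\cdots(m+2k-1)\,\underline{\partial}^{2k+1}\delta .$$ The signumdistributions. For $k\ge0$ and all $\varphi\in\mathcal{D}(\mathbb{R}^m)$,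 $$\langle\underline{\omega}\,\partial_r^{2k}\delta,\underline{\omega}\varphi\rangle=-\langle\partial_r^{2k}\delta,\varphi\rangle,\qquad \langle\partial_r^{2k+1}\delta,\underline{\omega}\varphi\rangle=\langle(\underline{\omega}\,\partial_r^{2k+1})\delta,\varphi\rangle .$$ Actions of $r$ and $\partial_r$ on the distributions $\partial_r^{2k}\delta$ and $(\underline{\omega}\,\partial_r^{2k+1})\delta$, $k\ge 0$, giving signumdistributions. For $T=\partial_r^{2k}\delta$ or $T=(\underline{\omega}\,\partial_r^{2k+1})\delta$, the signumdistribution $rT$ is defined by $\langle rT,\underline{\omega}\varphi\rangle=\langle\underline{x}\,T,\varphi\rangle$. The action of $\partial_r$ is defined by $$\langle\partial_r\,(\partial_r^{2k}\delta),\underline{\omega}\varphi\rangle=\langle(\underline{\omega}\,\partial_r^{2k+1})\delta,\varphi\rangle,\qquad \langle\partial_r\,(\underline{\omega}\,\partial_r^{2k+1})\delta,\underline{\omega}\varphi\rangle=-\langle\partial_r^{2k+2}\delta,\varphi\rangle .$$ *)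

theory Defs
  imports "HOL-Analysis.Analysis"
begin

typedef 'n clifford = "UNIV :: (real ^ ('n::finite) set) set"
  morphisms cl_coords cl_of_coords
  by simp

setup_lifting type_definition_clifford

instantiation clifford :: (finite) real_vector
begin
lift_definition zero_clifford :: "'a clifford" is 0 .
lift_definition plus_clifford :: "'a clifford \<Rightarrow> 'a clifford \<Rightarrow> 'a clifford" is "(+)" .
lift_definition minus_clifford :: "'a clifford \<Rightarrow> 'a clifford \<Rightarrow> 'a clifford" is "(-)" .
lift_definition uminus_clifford :: "'a clifford \<Rightarrow> 'a clifford" is uminus .
lift_definition scaleR_clifford :: "real \<Rightarrow> 'a clifford \<Rightarrow> 'a clifford" is "(*\<^sub>R)" .
instance
  by standard (transfer; simp add: algebra_simps)+
end

instantiation clifford :: (finite) real_inner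
begin
lift_definition norm_clifford :: "'a clifford \<Rightarrow> real" is norm .
lift_definition inner_clifford :: "'a clifford \<Rightarrow> 'a clifford \<Rightarrow> real" is inner .
definition dist_clifford :: "'a clifford \<Rightarrow> 'a clifford \<Rightarrow> real"
  where "dist_clifford a b = norm (a - b)"
definition sgn_clifford :: "'a clifford \<Rightarrow> 'a clifford"
  where "sgn_clifford a = a /\<^sub>R norm a"
definition uniformity_clifford :: "('a clifford \<times> 'a clifford) filter"
  where "uniformity_clifford = (INF e\<in>{0<..}. principal {(a, b). dist a b < e})"
definition open_clifford :: "'a clifford set \<Rightarrow> bool"
  where "open_clifford U \<longleftrightarrow>
    (\<forall>a\<in>U. eventually (\<lambda>(a', b). a' = a \<longrightarrow> b \<in> U) uniformity)"
instance
proof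
  fix a b c :: "'a clifford" and r :: real
  show "dist a b = norm (a - b)" by (rule dist_clifford_def)
  show "sgn a = a /\<^sub>R norm a" by (rule sgn_clifford_def)
  show "(uniformity :: ('a clifford \<times> 'a clifford) filter) =
      (INF e\<in>{0<..}. principal {(a, b). dist a b < e})"
    by (rule uniformity_clifford_def)
  show "open U \<longleftrightarrow> (\<forall>a\<in>U. eventually (\<lambda>(a', b). a' = a \<longrightarrow> b \<in> U) uniformity)"
    for U :: "'a clifford set" by (rule open_clifford_def)
  show "inner a b = inner b a" by transfer (rule inner_commute)
  show "inner (a + b) c = inner a c + inner b c" by transfer (rule inner_add_left)
  show "inner (r *\<^sub>R a) b = r * inner a b" by transfer simp
  show "0 \<le> inner a a" by transfer simp
  show "(inner a a = 0) = (a = 0)" by transfer simp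
  show "norm a = sqrt (inner a a)" by transfer (rule norm_eq_sqrt_inner)
qed
end

lift_definition blade :: "'n::finite set \<Rightarrow> 'n clifford" is "\<lambda>A. axis A 1" .

instantiation clifford :: (finite) euclidean_space
begin
definition Basis_clifford :: "'a clifford set" where "Basis_clifford = range blade"
lemma inner_blade: "inner (blade A) (blade B) = (if A = B then 1 else 0)"
  by transfer (simp add: inner_axis_axis)
instance
proof
  show "(Basis :: 'a clifford set) \<noteq> {}" "finite (Basis :: 'a clifford set)"
    by (simp_all add: Basis_clifford_def)
  fix u v :: "'a clifford"
  show "u \<in> Basis \<Longrightarrow> v \<in> Basis \<Longrightarrow> inner u v = (if u = v then 1 else 0)"
    by (auto simp: Basis_clifford_def inner_blade)
  show "(\<forall>v\<in>Basis. inner u v = 0) \<longleftrightarrow> (u = 0)"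
    unfolding Basis_clifford_def
    by transfer (auto simp: inner_axis vec_eq_iff)
qed
end

text \<open>For A = {a1 < ... < ap} the basis element blade A stands for the ordered product
  e_a1 ... e_ap. In the product of blade A and blade B, sorting the factors costs one sign for each
  pair a > b, and every common index contributes a further sign since e_j e_j = -1.\<close>

definition blade_sign :: "'n::{finite,linorder} set \<Rightarrow> 'n set \<Rightarrow> real"
  where "blade_sign A B =
    (-1) ^ card {(a, b). a \<in> A \<and> b \<in> B \<and> b < a} * (-1) ^ card (A \<inter> B)"

lemma blade_sign_eq_prod:
  "blade_sign A B = (\<Prod>a\<in>A. \<Prod>b\<in>B. if b \<le> a then -1 else 1)"
proof -
  have fin: "finite A" "finite B" for A B :: "'n::{finite,linorder} set" by auto
  let ?P = "{(a, b). a \<in> A \<and> b \<in> B \<and> b < a}" and ?Q = "(\<lambda>a. (a, a)) ` (A \<inter> B)"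
  have "(\<Prod>a\<in>A. \<Prod>b\<in>B. if b \<le> a then -1 else 1 :: real) =
      (\<Prod>p\<in>A \<times> B. if snd p \<le> fst p then -1 else 1)"
    by (simp add: prod.cartesian_product case_prod_beta)
  also have "\<dots> = (\<Prod>p\<in>{p \<in> A \<times> B. snd p \<le> fst p}. -1)"
    by (rule prod.mono_neutral_cong_right) auto
  also have "\<dots> = (-1) ^ card {p \<in> A \<times> B. snd p \<le> fst p}" by simp
  also have "{p \<in> A \<times> B. snd p \<le> fst p} = ?P \<union> ?Q" by force
  also have "card (?P \<union> ?Q) = card ?P + card ?Q"
    by (rule card_Un_disjoint) auto
  also have "card ?Q = card (A \<inter> B)"
    by (rule card_image) (auto simp: inj_on_def)
  finally show ?thesis by (simp add: blade_sign_def power_add)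
qed

lemma prod_sym_diff:
  fixes f :: "'n::finite \<Rightarrow> real"
  assumes "\<And>x. f x * f x = 1"
  shows "prod f (sym_diff A B) = prod f A * prod f B"
proof -
  have sq: "prod f (A \<inter> B) * prod f (A \<inter> B) = 1"
    by (simp add: assms flip: prod.distrib)
  have "prod f A = prod f (A - B) * prod f (A \<inter> B)" for A B
    by (subst prod.union_disjoint[symmetric]) (auto intro: arg_cong[of _ _ "prod f"])
  from this[of A B] this[of B A]
  have "prod f A = prod f (A - B) * prod f (A \<inter> B)" "prod f B = prod f (B - A) * prod f (A \<inter> B)"
    by (simp_all add: Int_commute)
  moreover have "prod f (sym_diff A B) = prod f (A - B) * prod f (B - A)"
    by (rule prod.union_disjoint) auto
  ultimately show ?thesis using sq by (simp add: algebra_simps)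
qed

lemma blade_sign_sym_diff:
  "blade_sign (sym_diff A B) C = blade_sign A C * blade_sign B C"
  "blade_sign A (sym_diff B C) = blade_sign A B * blade_sign A C"
proof -
  show "blade_sign (sym_diff A B) C = blade_sign A C * blade_sign B C"
    unfolding blade_sign_eq_prod
    by (rule prod_sym_diff) (auto simp flip: prod.distrib intro!: prod.neutral)
  have "(\<Prod>b\<in>sym_diff B C. if b \<le> a then -1 else 1 :: real) =
     (\<Prod>b\<in>B. if b \<le> a then -1 else 1) * (\<Prod>b\<in>C. if b \<le> a then -1 else 1)" for a
    by (rule prod_sym_diff) simp
  then show "blade_sign A (sym_diff B C) = blade_sign A B * blade_sign A C"
    unfolding blade_sign_eq_prod by (simp add: prod.distrib)
qed

lemma clifford_expansion: "(\<Sum>A\<in>UNIV. (cl_coords x $ A) *\<^sub>R blade A) = x"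
  for x :: "'n::finite clifford"
proof -
  have sum: "cl_coords (\<Sum>A\<in>S. f A) = (\<Sum>A\<in>S. cl_coords (f A))" if "finite S"
    for f :: "'n set \<Rightarrow> 'n clifford" and S
    using that by induction (simp_all add: zero_clifford.rep_eq plus_clifford.rep_eq)
  show ?thesis
    by (simp add: sum scaleR_clifford.rep_eq blade.rep_eq vec_eq_iff axis_def if_distrib
        sum.delta cong: if_cong flip: cl_coords_inject)
qed

instantiation clifford :: ("{finite,linorder}") real_algebra_1
begin
definition one_clifford :: "'a clifford" where "one_clifford = blade {}"
definition times_clifford :: "'a clifford \<Rightarrow> 'a clifford \<Rightarrow> 'a clifford"
  where "times_clifford x y = (\<Sum>A\<in>UNIV. \<Sum>B\<in>UNIV.
    (cl_coords x $ A * cl_coords y $ B * blade_sign A B) *\<^sub>R blade (sym_diff A B))"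

lemma blade_mult:
  "blade A * blade B = blade_sign A B *\<^sub>R blade (sym_diff A B)" for A :: "'a set"
proof -
  have "blade A * blade B = (\<Sum>A'\<in>UNIV. \<Sum>B'\<in>UNIV. if A' = A then if B' = B then
      blade_sign A B *\<^sub>R blade (sym_diff A B) else 0 else 0)"
    unfolding times_clifford_def blade.rep_eq
    by (intro sum.cong refl) (auto simp: axis_def)
  also have "\<dots> = (\<Sum>A'\<in>UNIV. if A' = A then (\<Sum>B'\<in>UNIV. if B' = B then
      blade_sign A B *\<^sub>R blade (sym_diff A B) else 0) else 0)"
    by (intro sum.cong refl) auto
  finally show ?thesis by simp
qed

lemma clifford_mult_linear:
  fixes a b c :: "'a clifford"
  shows "(a + b) * c = a * c + b * c" "a * (b + c) = a * b + a * c"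
    "r *\<^sub>R a * b = r *\<^sub>R (a * b)" "a * r *\<^sub>R b = r *\<^sub>R (a * b)"
  unfolding times_clifford_def
  by (simp_all add: plus_clifford.rep_eq scaleR_clifford.rep_eq algebra_simps sum.distrib
      scaleR_sum_right)

lemma clifford_mult_sum:
  fixes c :: "'a clifford"
  shows "(\<Sum>i\<in>S. f i) * c = (\<Sum>i\<in>S. f i * c)" "c * (\<Sum>i\<in>S. f i) = (\<Sum>i\<in>S. c * f i)"
proof -
  have "0 * c = 0" "c * 0 = 0"
    using clifford_mult_linear(3)[of 0 0 c] clifford_mult_linear(4)[of c 0 0] by simp_all
  then show "(\<Sum>i\<in>S. f i) * c = (\<Sum>i\<in>S. f i * c)" "c * (\<Sum>i\<in>S. f i) = (\<Sum>i\<in>S. c * f i)"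
    by (induction S rule: infinite_finite_induct; simp add: clifford_mult_linear)+
qed

instance
proof
  fix a b c :: "'a clifford" and r :: real
  have sd: "sym_diff (sym_diff A B) C = sym_diff A (sym_diff B C)" for A B C :: "'a set" by auto
  have bl: "blade A * blade B * blade C = blade A * (blade B * blade C)" for A B C :: "'a set"
    unfolding blade_mult clifford_mult_linear blade_sign_sym_diff sd by simp
  have "(\<Sum>A\<in>UNIV. (cl_coords a $ A) *\<^sub>R blade A) * (\<Sum>B\<in>UNIV. (cl_coords b $ B) *\<^sub>R blade B) *
        (\<Sum>C\<in>UNIV. (cl_coords c $ C) *\<^sub>R blade C) =
      (\<Sum>A\<in>UNIV. (cl_coords a $ A) *\<^sub>R blade A) * ((\<Sum>B\<in>UNIV. (cl_coords b $ B) *\<^sub>R blade B) *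
        (\<Sum>C\<in>UNIV. (cl_coords c $ C) *\<^sub>R blade C))"
    by (simp only: clifford_mult_sum clifford_mult_linear bl)
  then show "a * b * c = a * (b * c)" by (simp only: clifford_expansion)
  have one: "blade {} * blade A = blade A" "blade A * blade {} = blade A" for A :: "'a set"
    by (simp_all add: blade_mult blade_sign_def)
  have "1 * (\<Sum>A\<in>UNIV. (cl_coords a $ A) *\<^sub>R blade A) = (\<Sum>A\<in>UNIV. (cl_coords a $ A) *\<^sub>R blade A)"
    "(\<Sum>A\<in>UNIV. (cl_coords a $ A) *\<^sub>R blade A) * 1 = (\<Sum>A\<in>UNIV. (cl_coords a $ A) *\<^sub>R blade A)"
    by (simp_all add: clifford_mult_sum clifford_mult_linear one_clifford_def one)
  then show "1 * a = a" "a * 1 = a" by (simp_all add: clifford_expansion)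
  show "(a + b) * c = a * c + b * c" "a * (b + c) = a * b + a * c"
    "r *\<^sub>R a * b = r *\<^sub>R (a * b)" "a * r *\<^sub>R b = r *\<^sub>R (a * b)"
    by (fact clifford_mult_linear)+
  show "(0 :: 'a clifford) \<noteq> 1"
    using inner_blade[of "{} :: 'a set" "{}"] by (auto simp: one_clifford_def)
qed
end

definition cl_gen :: "'n::finite \<Rightarrow> 'n clifford" ("\<e>")
  where "\<e> j = blade {j}"

lemma cl_gen_square: "\<e> j * \<e> j = - 1"
  for j :: "'n::{finite,linorder}"
proof -
  have *: "{(a, b). a = j \<and> b = j \<and> b < a} = {}" by auto
  show ?thesis by (simp add: * cl_gen_def blade_mult blade_sign_def one_clifford_def)
qed

lemma cl_gen_anticommute:
  fixes i j :: "'n::{finite,linorder}"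
  assumes "i \<noteq> j"
  shows "\<e> i * \<e> j = - (\<e> j * \<e> i)"
proof -
  have *: "{(a, b). a = i \<and> b = j \<and> b < a} = (if j < i then {(i, j)} else {})" for i j :: 'n
    by auto
  show ?thesis
    using assms by (auto simp: cl_gen_def blade_mult blade_sign_def * insert_commute)
qed

definition partial_deriv :: "'n::finite \<Rightarrow> (real ^ 'n \<Rightarrow> real) \<Rightarrow> real ^ 'n \<Rightarrow> real"
  where "partial_deriv j f x = deriv (\<lambda>t. f (x + t *\<^sub>R axis j 1)) 0"

definition iter_partial :: "'n::finite list \<Rightarrow> (real ^ 'n \<Rightarrow> real) \<Rightarrow> real ^ 'n \<Rightarrow> real"
  where "iter_partial js f = foldr partial_deriv js f"

definition smooth :: "(real ^ 'n::finite \<Rightarrow> real) \<Rightarrow> bool"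
  where "smooth f \<longleftrightarrow> (\<forall>js x. iter_partial js f differentiable (at x))"

definition supp :: "(real ^ 'n::finite \<Rightarrow> real) \<Rightarrow> (real ^ 'n) set"
  where "supp f = closure {x. f x \<noteq> 0}"

lemma partial_deriv_eq:
  assumes "(f has_derivative D) (at x)"
  shows "partial_deriv j f x = D (axis j 1)"
proof -
  have "((\<lambda>t. f (x + t *\<^sub>R axis j 1)) has_derivative (\<lambda>t. D (t *\<^sub>R axis j 1))) (at 0)"
    by (rule has_derivative_compose[where g = f]) (use assms in \<open>auto intro!: derivative_eq_intros\<close>)
  moreover have "D (t *\<^sub>R axis j 1) = D (axis j 1) * t" for t
    using has_derivative_linear[OF assms] by (simp add: linear_cmul)
  ultimately have "((\<lambda>t. f (x + t *\<^sub>R axis j 1)) has_field_derivative D (axis j 1)) (at 0)"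
    by (simp add: has_field_derivative_def)
  then show ?thesis unfolding partial_deriv_def by (rule DERIV_imp_deriv)
qed

lemma iter_partial_Nil [simp]: "iter_partial [] f = f"
  and iter_partial_snoc [simp]: "iter_partial (js @ [j]) f = iter_partial js (partial_deriv j f)"
  by (simp_all add: iter_partial_def)

lemma smooth_differentiable: "smooth f \<Longrightarrow> f differentiable (at x)"
  unfolding smooth_def by (metis iter_partial_Nil)

lemma smooth_partial: "smooth f \<Longrightarrow> smooth (partial_deriv j f)"
  unfolding smooth_def by (metis iter_partial_snoc)

lemma smooth_coinduct:
  assumes "f \<in> S"
    and "\<And>f x. f \<in> S \<Longrightarrow> f differentiable (at x)"
    and "\<And>f j. f \<in> S \<Longrightarrow> partial_deriv j f \<in> S"
  shows "smooth f"
proof -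
  have "iter_partial js f \<in> S" if "f \<in> S" for js f
    using that by (induction js arbitrary: f rule: rev_induct) (auto simp: assms(3))
  then show ?thesis using assms by (auto simp: smooth_def)
qed

lemma
  assumes "f differentiable (at x)" "g differentiable (at x)"
  shows differentiable_lincomb: "(\<lambda>x. a * f x + b * g x) differentiable (at x)"
    and partial_deriv_lincomb:
      "partial_deriv j (\<lambda>x. a * f x + b * g x) x = a * partial_deriv j f x + b * partial_deriv j g x"
proof -
  obtain F G where F: "(f has_derivative F) (at x)" and G: "(g has_derivative G) (at x)"
    using assms by (auto simp: differentiable_def)
  have D: "((\<lambda>x. a * f x + b * g x) has_derivative (\<lambda>h. a * F h + b * G h)) (at x)"
    by (intro has_derivative_add has_derivative_mult_right F G)
  then show "(\<lambda>x. a * f x + b * g x) differentiable (at x)" unfolding differentiable_def by blast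
  show "partial_deriv j (\<lambda>x. a * f x + b * g x) x = a * partial_deriv j f x + b * partial_deriv j g x"
    by (simp only: partial_deriv_eq[OF D] partial_deriv_eq[OF F] partial_deriv_eq[OF G])
qed

lemma
  assumes "f differentiable (at x)"
  shows coord_mult_differentiable: "(\<lambda>x. x $ j * f x) differentiable (at x)"
    and partial_deriv_coord: "partial_deriv i (\<lambda>x. x $ j * f x) x =
      x $ j * partial_deriv i f x + (if i = j then 1 else 0) * f x"
proof -
  obtain F where F: "(f has_derivative F) (at x)"
    using assms by (auto simp: differentiable_def)
  have D: "((\<lambda>x. x $ j * f x) has_derivative (\<lambda>h. x $ j * F h + h $ j * f x)) (at x)"
    by (rule has_derivative_mult[OF bounded_linear_imp_has_derivative[OF bounded_linear_vec_nth] F])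
  then show "(\<lambda>x. x $ j * f x) differentiable (at x)" unfolding differentiable_def by blast
  show "partial_deriv i (\<lambda>x. x $ j * f x) x =
      x $ j * partial_deriv i f x + (if i = j then 1 else 0) * f x"
    unfolding partial_deriv_eq[OF D] partial_deriv_eq[OF F] by (simp add: axis_def)
qed

lemma smooth_zero: "smooth (\<lambda>x. 0)"
proof (rule smooth_coinduct[of _ "{\<lambda>x. 0}"])
  have "partial_deriv j (\<lambda>x. 0) = (\<lambda>x. 0)" for j :: 'a
    by (rule ext) (use partial_deriv_eq[OF has_derivative_const] in auto)
  then show "f \<in> {\<lambda>x. 0} \<Longrightarrow> partial_deriv j f \<in> {\<lambda>x. 0}" for j :: 'a and f by simp
qed auto

lemma smooth_lincomb:
  assumes "smooth f" "smooth g"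
  shows "smooth (\<lambda>x. a * f x + b * g x)"
proof (rule smooth_coinduct[of _ "{h. \<exists>f g. smooth f \<and> smooth g \<and> h = (\<lambda>x. a * f x + b * g x)}"])
  show "(\<lambda>x. a * f x + b * g x) \<in> {h. \<exists>f g. smooth f \<and> smooth g \<and> h = (\<lambda>x. a * f x + b * g x)}"
    using assms by blast
next
  fix h x assume "h \<in> {h. \<exists>f g. smooth f \<and> smooth g \<and> h = (\<lambda>x. a * f x + b * g x)}"
  then show "h differentiable (at x)"
    using differentiable_lincomb smooth_differentiable by blast
next
  fix h j assume "h \<in> {h. \<exists>f g. smooth f \<and> smooth g \<and> h = (\<lambda>x. a * f x + b * g x)}"
  then obtain f g where "smooth f" "smooth g" "h = (\<lambda>x. a * f x + b * g x)" by blast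
  moreover from this have
    "partial_deriv j h = (\<lambda>x. a * partial_deriv j f x + b * partial_deriv j g x)"
    by (auto simp: partial_deriv_lincomb smooth_differentiable)
  ultimately show "partial_deriv j h \<in> {h. \<exists>f g. smooth f \<and> smooth g \<and> h = (\<lambda>x. a * f x + b * g x)}"
    using smooth_partial by blast
qed

lemma iter_partial_lincomb:
  assumes "smooth f" "smooth g"
  shows "iter_partial js (\<lambda>x. a * f x + b * g x) x = a * iter_partial js f x + b * iter_partial js g x"
  using assms
proof (induction js arbitrary: f g rule: rev_induct)
  case (snoc j js)
  have "partial_deriv j (\<lambda>x. a * f x + b * g x) = (\<lambda>x. a * partial_deriv j f x + b * partial_deriv j g x)"
    using snoc.prems by (auto simp: partial_deriv_lincomb smooth_differentiable)
  then show ?case using snoc by (simp add: smooth_partial)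
qed simp

lemma smooth_coord_mult:
  assumes "smooth f"
  shows "smooth (\<lambda>x. x $ j * f x)"
proof -
  define S where "S = {h. \<exists>f g. smooth f \<and> smooth g \<and> h = (\<lambda>x. 1 * (x $ j * f x) + 1 * g x)}"
  have diff: "(\<lambda>x. x $ j * f x) differentiable (at x)" "g differentiable (at x)"
    if "smooth f" "smooth g" for f g x
    using that by (auto intro: coord_mult_differentiable smooth_differentiable)
  have "(\<lambda>x. x $ j * f x) = (\<lambda>x. 1 * (x $ j * f x) + 1 * 0)" by simp
  then have "(\<lambda>x. x $ j * f x) \<in> S" using assms smooth_zero unfolding S_def by blast
  then show ?thesis
  proof (rule smooth_coinduct)
    fix h x assume "h \<in> S"
    then show "h differentiable (at x)"
      unfolding S_def using diff differentiable_lincomb by blast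
  next
    fix h i assume "h \<in> S"
    then obtain f g where fg: "smooth f" "smooth g" "h = (\<lambda>x. 1 * (x $ j * f x) + 1 * g x)"
      unfolding S_def by blast
    then have "partial_deriv i h = (\<lambda>x. 1 * (x $ j * partial_deriv i f x) +
        1 * ((if i = j then 1 else 0) * f x + 1 * partial_deriv i g x))"
      unfolding fg(3) partial_deriv_lincomb[OF diff[OF fg(1,2)]]
        partial_deriv_coord[OF smooth_differentiable[OF fg(1)]] by (simp add: add.assoc)
    moreover have "smooth (\<lambda>x. (if i = j then 1 else 0) * f x + 1 * partial_deriv i g x)"
      using fg by (intro smooth_lincomb smooth_partial)
    ultimately show "partial_deriv i h \<in> S"
      unfolding S_def using smooth_partial[OF fg(1)] by blast
  qed
qed

lemma iter_partial_coord_mult_bound: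
  assumes "smooth f"
    and "\<And>js' x. length js' \<le> length js \<Longrightarrow> \<bar>iter_partial js' f x\<bar> \<le> e"
  shows "\<bar>iter_partial js (\<lambda>x. x $ j * f x) x\<bar> \<le> (\<bar>x $ j\<bar> + length js) * e"
  using assms
proof (induction js arbitrary: f rule: rev_induct)
  case Nil
  from Nil.prems(2)[of "[]" x] show ?case by (simp add: abs_mult mult_left_mono)
next
  case (snoc i js)
  define c :: real where "c = (if i = j then 1 else 0)"
  have eq: "partial_deriv i (\<lambda>x. x $ j * f x) =
      (\<lambda>x. 1 * (x $ j * partial_deriv i f x) + c * f x)"
    using snoc.prems by (auto simp: partial_deriv_coord smooth_differentiable c_def)
  have "iter_partial (js @ [i]) (\<lambda>x. x $ j * f x) x =
      iter_partial js (\<lambda>x. x $ j * partial_deriv i f x) x + c * iter_partial js f x"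
    unfolding iter_partial_snoc eq using snoc.prems
    by (subst iter_partial_lincomb) (auto intro: smooth_coord_mult smooth_partial)
  moreover have "\<bar>iter_partial js (\<lambda>x. x $ j * partial_deriv i f x) x\<bar> \<le> (\<bar>x $ j\<bar> + length js) * e"
  proof (rule snoc.IH)
    show "smooth (partial_deriv i f)" using snoc.prems by (simp add: smooth_partial)
    show "\<bar>iter_partial js' (partial_deriv i f) y\<bar> \<le> e" if "length js' \<le> length js" for js' y
      using snoc.prems(2)[of "js' @ [i]" y] that by simp
  qed
  moreover have "\<bar>c * iter_partial js f x\<bar> \<le> e"
    using snoc.prems(2)[of js x] snoc.prems(2)[of "[]" x] by (auto simp: c_def)
  ultimately show ?case by (simp add: algebra_simps)
qed

lemma compact_supp_bounded:
  assumes "compact K" "supp f \<subseteq> K"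
  shows "compact (supp f)"
  using assms unfolding supp_def by (metis closed_closure compact_Int_closed inf.absorb_iff2)

lemma supp_subset: "(\<And>x. f x \<noteq> 0 \<Longrightarrow> g x \<noteq> 0) \<Longrightarrow> supp f \<subseteq> supp g"
  unfolding supp_def by (rule closure_mono) auto

lemma supp_lincomb: "supp (\<lambda>x. a * f x + b * g x) \<subseteq> supp f \<union> supp g"
  unfolding supp_def closure_Un[symmetric] by (rule closure_mono) auto

lemma supp_partial: "supp (partial_deriv j f) \<subseteq> supp f"
proof -
  have "partial_deriv j f x = 0" if "x \<notin> supp f" for x
  proof -
    have "open (- supp f)" unfolding supp_def by (simp add: open_Compl)
    moreover have "0 = f y" if "y \<in> - supp f" for y
      using that closure_subset[of "{x. f x \<noteq> 0}"] by (auto simp: supp_def)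
    ultimately have "(f has_derivative (\<lambda>_. 0)) (at x)"
      using that by (intro has_derivative_transform_within_open[OF has_derivative_const]) auto
    then show ?thesis by (simp add: partial_deriv_eq)
  qed
  then have "{x. partial_deriv j f x \<noteq> 0} \<subseteq> supp f" by auto
  then show ?thesis by (metis closed_closure closure_minimal supp_def)
qed

typedef 'n test_fun = "{\<phi> :: real ^ 'n::finite \<Rightarrow> real. smooth \<phi> \<and> compact (supp \<phi>)}"
  morphisms test_apply Test_fun
  by (rule exI[of _ "\<lambda>x. 0"]) (simp add: smooth_zero supp_def)

setup_lifting type_definition_test_fun

lemma is_test_lincomb:
  assumes "smooth f \<and> compact (supp f)" "smooth g \<and> compact (supp g)"
  shows "smooth (\<lambda>x. a * f x + b * g x) \<and> compact (supp (\<lambda>x. a * f x + b * g x))"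
  using assms smooth_lincomb compact_supp_bounded[OF compact_Un supp_lincomb] by blast

instantiation test_fun :: (finite) real_vector
begin
lift_definition zero_test_fun :: "'a test_fun" is "\<lambda>x. 0"
  by (simp add: smooth_zero supp_def)
lift_definition plus_test_fun :: "'a test_fun \<Rightarrow> 'a test_fun \<Rightarrow> 'a test_fun"
  is "\<lambda>f g x. f x + g x"
  using is_test_lincomb[where a = 1 and b = 1] by simp
lift_definition minus_test_fun :: "'a test_fun \<Rightarrow> 'a test_fun \<Rightarrow> 'a test_fun"
  is "\<lambda>f g x. f x - g x"
  using is_test_lincomb[where a = 1 and b = "-1"] by simp
lift_definition uminus_test_fun :: "'a test_fun \<Rightarrow> 'a test_fun" is "\<lambda>f x. - f x"
  using is_test_lincomb[where a = "-1" and b = 0] by simp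
lift_definition scaleR_test_fun :: "real \<Rightarrow> 'a test_fun \<Rightarrow> 'a test_fun" is "\<lambda>c f x. c * f x"
  using is_test_lincomb[where b = 0] by simp
instance
  by standard (transfer; simp add: algebra_simps)+
end

lift_definition test_partial :: "'n::finite \<Rightarrow> 'n test_fun \<Rightarrow> 'n test_fun" is partial_deriv
  by (meson compact_supp_bounded smooth_partial supp_partial)

lift_definition test_coord_mult :: "'n::finite \<Rightarrow> 'n test_fun \<Rightarrow> 'n test_fun"
  is "\<lambda>j \<phi> x. x $ j * \<phi> x"
proof -
  fix j :: 'n and \<phi> :: "real ^ 'n \<Rightarrow> real"
  assume "smooth \<phi> \<and> compact (supp \<phi>)"
  moreover have "supp (\<lambda>x. x $ j * \<phi> x) \<subseteq> supp \<phi>" by (rule supp_subset) auto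
  ultimately show "smooth (\<lambda>x. x $ j * \<phi> x) \<and> compact (supp (\<lambda>x. x $ j * \<phi> x))"
    using compact_supp_bounded smooth_coord_mult by blast
qed

text \<open>The usual inductive limit topology of the space of test functions: a basis of
  neighbourhoods of zero consists of the convex balanced sets whose trace on the test functions
  supported in K is a neighbourhood of zero for uniform convergence of all partial derivatives,
  for every compact K.\<close>

definition seminorm_ball :: "(real ^ 'n::finite) set \<Rightarrow> nat \<Rightarrow> real \<Rightarrow> 'n test_fun set"
  where "seminorm_ball K N e = {\<phi>. supp (test_apply \<phi>) \<subseteq> K \<and>
    (\<forall>js x. length js \<le> N \<longrightarrow> \<bar>iter_partial js (test_apply \<phi>) x\<bar> \<le> e)}"

definition basic_nbhd :: "'n::finite test_fun set \<Rightarrow> bool"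
  where "basic_nbhd V \<longleftrightarrow> convex V \<and> (\<forall>\<phi>\<in>V. \<forall>c. \<bar>c\<bar> \<le> 1 \<longrightarrow> c *\<^sub>R \<phi> \<in> V) \<and>
    (\<forall>K. compact K \<longrightarrow> (\<exists>N. \<exists>e>0. seminorm_ball K N e \<subseteq> V))"

definition test_topology :: "'n::finite test_fun topology"
  where "test_topology = topology (\<lambda>U. \<forall>\<phi>\<in>U. \<exists>V. basic_nbhd V \<and> (+) \<phi> ` V \<subseteq> U)"

lemma seminorm_ball_mono:
  "N' \<le> N \<Longrightarrow> e \<le> e' \<Longrightarrow> seminorm_ball K N e \<subseteq> seminorm_ball K N' e'"
  unfolding seminorm_ball_def by (auto intro: order_trans)

lemma basic_nbhd_seminorm_ball:
  assumes "basic_nbhd V" "compact K"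
  shows "\<exists>N. \<exists>e>0. seminorm_ball K N e \<subseteq> V"
  using assms unfolding basic_nbhd_def by simp

lemma basic_nbhd_Int:
  assumes "basic_nbhd V" "basic_nbhd W"
  shows "basic_nbhd (V \<inter> W)"
proof -
  have "\<exists>N. \<exists>e>0. seminorm_ball K N e \<subseteq> V \<inter> W" if K: "compact K" for K
  proof -
    obtain N e where "e > 0" "seminorm_ball K N e \<subseteq> V"
      using basic_nbhd_seminorm_ball[OF assms(1) K] by blast
    moreover obtain N' e' where "e' > 0" "seminorm_ball K N' e' \<subseteq> W"
      using basic_nbhd_seminorm_ball[OF assms(2) K] by blast
    ultimately have "min e e' > 0" "seminorm_ball K (max N N') (min e e') \<subseteq> V \<inter> W"
      using seminorm_ball_mono[of N "max N N'" "min e e'" e K]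
        seminorm_ball_mono[of N' "max N N'" "min e e'" e' K] by auto
    then show ?thesis by blast
  qed
  then show ?thesis using assms unfolding basic_nbhd_def by (simp add: convex_Int)
qed

lemma openin_test_topology:
  "openin test_topology U \<longleftrightarrow> (\<forall>\<phi>\<in>U. \<exists>V. basic_nbhd V \<and> (+) \<phi> ` V \<subseteq> U)"
  for U :: "'n::finite test_fun set"
proof -
  have "istopology (\<lambda>U :: 'n test_fun set. \<forall>\<phi>\<in>U. \<exists>V. basic_nbhd V \<and> (+) \<phi> ` V \<subseteq> U)"
    unfolding istopology_def
  proof (intro conjI allI impI ballI)
    fix S T :: "'n test_fun set" and \<phi>
    assume "\<forall>\<phi>\<in>S. \<exists>V. basic_nbhd V \<and> (+) \<phi> ` V \<subseteq> S" "\<forall>\<phi>\<in>T. \<exists>V. basic_nbhd V \<and> (+) \<phi> ` V \<subseteq> T"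
      "\<phi> \<in> S \<inter> T"
    then obtain V W where "basic_nbhd V" "(+) \<phi> ` V \<subseteq> S" "basic_nbhd W" "(+) \<phi> ` W \<subseteq> T" by blast
    then show "\<exists>V. basic_nbhd V \<and> (+) \<phi> ` V \<subseteq> S \<inter> T"
      by (intro exI[of _ "V \<inter> W"]) (auto simp: basic_nbhd_Int)
  next
    fix \<K> :: "'n test_fun set set" and \<phi>
    assume K: "\<forall>U\<in>\<K>. \<forall>\<phi>\<in>U. \<exists>V. basic_nbhd V \<and> (+) \<phi> ` V \<subseteq> U" and "\<phi> \<in> \<Union>\<K>"
    then obtain U where "U \<in> \<K>" "\<phi> \<in> U" by blast
    with K obtain V where "basic_nbhd V" "(+) \<phi> ` V \<subseteq> U" by blast
    with \<open>U \<in> \<K>\<close> have "(+) \<phi> ` V \<subseteq> \<Union>\<K>" by blast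
    with \<open>basic_nbhd V\<close> show "\<exists>V. basic_nbhd V \<and> (+) \<phi> ` V \<subseteq> \<Union>\<K>" by blast
  qed
  then show ?thesis unfolding test_topology_def by (simp add: topology_inverse')
qed

lemma topspace_test_topology [simp]: "topspace test_topology = (UNIV :: 'n::finite test_fun set)"
proof -
  have "basic_nbhd (UNIV :: 'n test_fun set)"
    unfolding basic_nbhd_def by (simp add: gt_ex)
  then have "openin test_topology (UNIV :: 'n test_fun set)"
    unfolding openin_test_topology by (meson UNIV_I subset_UNIV)
  from openin_subset[OF this] show ?thesis by auto
qed

lemma basic_nbhd_vimage:
  assumes L: "linear L" and V: "convex V" "\<And>\<phi> c. \<phi> \<in> V \<Longrightarrow> \<bar>c\<bar> \<le> 1 \<Longrightarrow> c *\<^sub>R \<phi> \<in> V"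
    and "\<And>K. compact K \<Longrightarrow> \<exists>N. \<exists>e>0. L ` seminorm_ball K N e \<subseteq> V"
  shows "basic_nbhd (L -` V)"
  unfolding basic_nbhd_def using assms
  by (auto simp: convex_linear_vimage linear_cmul image_subset_iff_subset_vimage)

lemma continuous_map_test_test:
  assumes L: "linear L"
    and b: "\<And>K. compact K \<Longrightarrow> \<exists>K'. compact K' \<and>
      (\<forall>N. \<forall>e>0. \<exists>N'. \<exists>e'>0. L ` seminorm_ball K N' e' \<subseteq> seminorm_ball K' N e)"
  shows "continuous_map test_topology test_topology L"
  unfolding continuous_map
proof (intro conjI allI impI)
  fix U :: "'b test_fun set"
  assume U: "openin test_topology U"
  have "openin test_topology (L -` U)"
    unfolding openin_test_topology
  proof
    fix \<phi> assume "\<phi> \<in> L -` U"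
    then obtain V where V: "basic_nbhd V" "(+) (L \<phi>) ` V \<subseteq> U"
      using U unfolding openin_test_topology by blast
    have "basic_nbhd (L -` V)"
    proof (rule basic_nbhd_vimage[OF L])
      fix K :: "(real ^ 'a) set" assume "compact K"
      from b[OF this] obtain K' where K': "compact K'"
        "\<And>N e. e > 0 \<Longrightarrow> \<exists>N'. \<exists>e'>0. L ` seminorm_ball K N' e' \<subseteq> seminorm_ball K' N e"
        by auto
      obtain N e where "e > 0" "seminorm_ball K' N e \<subseteq> V"
        using basic_nbhd_seminorm_ball[OF V(1) K'(1)] by blast
      with K'(2)[of e N] show "\<exists>N. \<exists>e>0. L ` seminorm_ball K N e \<subseteq> V"
        by (meson subset_trans)
    qed (use V(1) in \<open>auto simp: basic_nbhd_def\<close>)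
    moreover have "(+) \<phi> ` (L -` V) \<subseteq> L -` U"
      using V(2) by (auto simp: linear_add[OF L])
    ultimately show "\<exists>V. basic_nbhd V \<and> (+) \<phi> ` V \<subseteq> L -` U" by blast
  qed
  then show "openin test_topology {x \<in> topspace test_topology. L x \<in> U}" by (simp add: vimage_def)
qed auto

lemma continuous_map_test_euclidean:
  fixes L :: "'n::finite test_fun \<Rightarrow> 'b::real_normed_vector"
  assumes L: "linear L"
    and b: "\<And>K d. compact K \<Longrightarrow> d > 0 \<Longrightarrow> \<exists>N. \<exists>e>0. \<forall>\<phi>\<in>seminorm_ball K N e. norm (L \<phi>) < d"
  shows "continuous_map test_topology euclidean L"
  unfolding continuous_map
proof (intro conjI allI impI)
  fix U :: "'b set" assume U: "openin euclidean U"
  have "openin test_topology (L -` U)"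
    unfolding openin_test_topology
  proof
    fix \<phi> assume "\<phi> \<in> L -` U"
    then obtain d where d: "d > 0" "ball (L \<phi>) d \<subseteq> U"
      using U open_contains_ball by (metis open_openin vimageE)
    have "basic_nbhd (L -` ball 0 d)"
    proof (rule basic_nbhd_vimage[OF L])
      show "c *\<^sub>R y \<in> ball 0 d" if "y \<in> ball 0 d" "\<bar>c\<bar> \<le> 1" for y :: 'b and c
        using that mult_left_le_one_le[of "norm y" "\<bar>c\<bar>"] by simp
      show "\<exists>N. \<exists>e>0. L ` seminorm_ball K N e \<subseteq> ball 0 d" if "compact K" for K
        using b[OF that d(1)] by (simp add: image_subset_iff)
    qed auto
    moreover have "(+) \<phi> ` (L -` ball 0 d) \<subseteq> L -` U"
      using d(2) by (auto simp: linear_add[OF L] dist_norm subset_iff)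
    ultimately show "\<exists>V. basic_nbhd V \<and> (+) \<phi> ` V \<subseteq> L -` U" by blast
  qed
  then show "openin test_topology {x \<in> topspace test_topology. L x \<in> U}" by (simp add: vimage_def)
qed auto

lemma linear_test_partial: "linear (test_partial j)"
proof (rule linearI)
  show "test_partial j (f + g) = test_partial j f + test_partial j g" for f g
    by transfer (use partial_deriv_lincomb[where a = 1 and b = 1] smooth_differentiable in fastforce)
  show "test_partial j (c *\<^sub>R f) = c *\<^sub>R test_partial j f" for c f
    by transfer (use partial_deriv_lincomb[where a = c and b = 0 for c] smooth_differentiable in fastforce)
qed

lemma continuous_test_partial: "continuous_map test_topology test_topology (test_partial j)"
proof (rule continuous_map_test_test[OF linear_test_partial])
  fix K :: "(real ^ 'a) set" assume "compact K"
  moreover have "test_partial j ` seminorm_ball K (Suc N) e \<subseteq> seminorm_ball K N e" for N e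
  proof -
    have "\<bar>iter_partial js (partial_deriv j f) x\<bar> \<le> e"
      if "\<forall>js x. length js \<le> Suc N \<longrightarrow> \<bar>iter_partial js f x\<bar> \<le> e" "length js \<le> N" for f js x
      using that(1)[rule_format, of "js @ [j]" x] that(2) by simp
    then show ?thesis
      unfolding seminorm_ball_def
      by (auto simp: test_partial.rep_eq dest!: supp_partial[THEN subsetD])
  qed
  ultimately show "\<exists>K'. compact K' \<and>
      (\<forall>N. \<forall>e>0. \<exists>N'. \<exists>e'>0. test_partial j ` seminorm_ball K N' e' \<subseteq> seminorm_ball K' N e)"
    by meson
qed

lemma linear_test_coord_mult: "linear (test_coord_mult j)"
  by (rule linearI; transfer) (auto simp: algebra_simps)

lemma continuous_test_coord_mult:
  "continuous_map test_topology test_topology (test_coord_mult j)"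
proof (rule continuous_map_test_test[OF linear_test_coord_mult])
  fix K :: "(real ^ 'a) set" assume K: "compact K"
  then obtain M where M: "\<And>x. x \<in> K \<Longrightarrow> norm x \<le> M" "M > 0"
    using compact_imp_bounded bounded_pos by metis
  have "test_coord_mult j ` seminorm_ball K N (e / (M + N)) \<subseteq> seminorm_ball K N e" if "e > 0" for N e
  proof
    fix \<psi> assume "\<psi> \<in> test_coord_mult j ` seminorm_ball K N (e / (M + N))"
    then obtain \<phi> where \<phi>: "\<phi> \<in> seminorm_ball K N (e / (M + N))" "\<psi> = test_coord_mult j \<phi>" by auto
    define f where "f = test_apply \<phi>"
    have f: "smooth f" "supp f \<subseteq> K"
      "\<And>js x. length js \<le> N \<Longrightarrow> \<bar>iter_partial js f x\<bar> \<le> e / (M + N)"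
      using \<phi> test_apply[of \<phi>] by (auto simp: f_def seminorm_ball_def)
    have sup: "supp (\<lambda>x. x $ j * f x) \<subseteq> K"
      using f(2) supp_subset[of "\<lambda>x. x $ j * f x" f] by auto
    have out: "iter_partial js g x = 0" if "supp g \<subseteq> K" "x \<notin> K" for js g x
    proof -
      have "supp (iter_partial js g) \<subseteq> K"
        using that(1)
      proof (induction js arbitrary: g rule: rev_induct)
        case (snoc i js)
        then show ?case using supp_partial[of i g] by (metis iter_partial_snoc subset_trans)
      qed simp
      then show ?thesis
        using that(2) closure_subset[of "{x. iter_partial js g x \<noteq> 0}"] by (auto simp: supp_def)
    qed
    have "\<bar>iter_partial js (\<lambda>x. x $ j * f x) x\<bar> \<le> e" if "length js \<le> N" for js x
    proof (cases "x \<in> K")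
      case True
      have "\<bar>iter_partial js (\<lambda>x. x $ j * f x) x\<bar> \<le> (\<bar>x $ j\<bar> + length js) * (e / (M + N))"
        using f that by (intro iter_partial_coord_mult_bound) auto
      also have "\<dots> \<le> (M + N) * (e / (M + N))"
        using M(1)[OF True] component_le_norm_cart[of x j] that \<open>M > 0\<close> \<open>e > 0\<close>
        by (intro mult_right_mono) auto
      finally show ?thesis using \<open>M > 0\<close> by simp
    qed (use out[OF sup] \<open>e > 0\<close> in simp)
    then show "\<psi> \<in> seminorm_ball K N e"
      using sup unfolding seminorm_ball_def by (simp add: \<phi>(2) test_coord_mult.rep_eq f_def)
  qed
  then show "\<exists>K'. compact K' \<and>
      (\<forall>N. \<forall>e>0. \<exists>N'. \<exists>e'>0. test_coord_mult j ` seminorm_ball K N' e' \<subseteq> seminorm_ball K' N e)"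
    using K M(2) by (metis add_pos_nonneg divide_pos_pos of_nat_0_le_iff)
qed

lemma continuous_map_clifford_mult:
  "continuous_map X euclidean T \<Longrightarrow> continuous_map X euclidean (\<lambda>\<phi>. c * T \<phi>)"
  for c :: "'n::{finite,linorder} clifford"
proof -
  have "linear ((*) c)" by (rule linearI) (simp_all add: algebra_simps)
  then have "continuous_map euclidean euclidean ((*) c)" by (simp add: linear_continuous_on linear_linear)
  then show "continuous_map X euclidean T \<Longrightarrow> continuous_map X euclidean (\<lambda>\<phi>. c * T \<phi>)"
    using continuous_map_compose[of X euclidean T euclidean "(*) c"] by (simp add: o_def)
qed

lemma continuous_map_scale:
  "continuous_map X euclidean T \<Longrightarrow> continuous_map X euclidean (\<lambda>\<phi>. r *\<^sub>R T \<phi>)"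
  for T :: "_ \<Rightarrow> 'b::real_normed_vector"
  using continuous_map_compose[of X euclidean T euclidean "(*\<^sub>R) r"]
  by (simp add: o_def continuous_on_scaleR)

typedef 'n distribution = "{T :: 'n::finite test_fun \<Rightarrow> 'n clifford.
    linear T \<and> continuous_map test_topology euclidean T}"
  morphisms dist_apply Distribution
  by (rule exI[of _ "\<lambda>_. 0"]) (simp add: linear_zero)

setup_lifting type_definition_distribution

instantiation distribution :: (finite) real_vector
begin
lift_definition zero_distribution :: "'a distribution" is "\<lambda>_. 0" by (simp add: linear_zero)
lift_definition plus_distribution :: "'a distribution \<Rightarrow> 'a distribution \<Rightarrow> 'a distribution"
  is "\<lambda>S T \<phi>. S \<phi> + T \<phi>" by (simp add: linear_compose_add continuous_map_add)
lift_definition minus_distribution :: "'a distribution \<Rightarrow> 'a distribution \<Rightarrow> 'a distribution"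
  is "\<lambda>S T \<phi>. S \<phi> - T \<phi>" by (simp add: linear_compose_sub continuous_map_diff)
lift_definition uminus_distribution :: "'a distribution \<Rightarrow> 'a distribution"
  is "\<lambda>T \<phi>. - T \<phi>" by (simp add: linear_compose_neg)
lift_definition scaleR_distribution :: "real \<Rightarrow> 'a distribution \<Rightarrow> 'a distribution"
  is "\<lambda>r T \<phi>. r *\<^sub>R T \<phi>" by (simp add: linear_compose_scale_right continuous_map_scale)
instance
  by standard (transfer; simp add: algebra_simps)+
end

lift_definition delta :: "'n::{finite,linorder} distribution"
  is "\<lambda>\<phi> :: 'n test_fun. of_real (test_apply \<phi> 0)"
proof
  show lin: "linear (\<lambda>\<phi> :: 'n test_fun. of_real (test_apply \<phi> 0) :: 'n clifford)"
    by (rule linearI) (simp_all add: plus_test_fun.rep_eq scaleR_test_fun.rep_eq scaleR_conv_of_real)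
  show "continuous_map test_topology euclidean
      (\<lambda>\<phi> :: 'n test_fun. of_real (test_apply \<phi> 0) :: 'n clifford)"
  proof (rule continuous_map_test_euclidean[OF lin])
    fix K and d :: real assume "d > 0"
    have "norm (of_real r :: 'n clifford) = \<bar>r\<bar>" for r
    proof -
      have "norm (1 :: 'n clifford) = 1" by (simp add: norm_eq_sqrt_inner one_clifford_def inner_blade)
      then show ?thesis by (simp add: of_real_def)
    qed
    moreover have "\<bar>test_apply \<phi> 0\<bar> < d" if "\<phi> \<in> seminorm_ball K 0 (d / 2)" for \<phi>
    proof -
      have "\<bar>iter_partial [] (test_apply \<phi>) 0\<bar> \<le> d / 2"
        using that unfolding seminorm_ball_def by simp
      then show ?thesis using \<open>d > 0\<close> by simp
    qed
    ultimately have
      "\<forall>\<phi>\<in>seminorm_ball K 0 (d / 2). norm (of_real (test_apply \<phi> 0) :: 'n clifford) < d"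
      by simp
    then show "\<exists>N. \<exists>e>0. \<forall>\<phi>\<in>seminorm_ball K N e. norm (of_real (test_apply \<phi> 0) :: 'n clifford) < d"
      using \<open>d > 0\<close> by (meson half_gt_zero)
  qed
qed

lemma clifford_mult_compose:
  fixes T :: "'n::{finite,linorder} test_fun \<Rightarrow> 'n clifford"
  assumes "linear T \<and> continuous_map test_topology euclidean T"
    and "\<And>j. linear (L j)" "\<And>j. continuous_map test_topology test_topology (L j)"
  shows "linear (\<lambda>\<phi>. \<Sum>j\<in>UNIV. \<e> j * T (L j \<phi>)) \<and>
    continuous_map test_topology euclidean (\<lambda>\<phi>. \<Sum>j\<in>UNIV. \<e> j * T (L j \<phi>))"
proof
  have "linear (\<lambda>\<phi>. \<e> j * T (L j \<phi>))" for j
    using assms by (auto intro!: linearI simp: linear_add linear_cmul algebra_simps)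
  then show "linear (\<lambda>\<phi>. \<Sum>j\<in>UNIV. \<e> j * T (L j \<phi>))"
    by (rule linear_compose_sum[rule_format])
  have "continuous_map test_topology euclidean (\<lambda>\<phi>. \<e> j * T (L j \<phi>))" for j
    using assms continuous_map_compose[of test_topology test_topology "L j" euclidean T]
    by (simp add: o_def continuous_map_clifford_mult)
  then show "continuous_map test_topology euclidean (\<lambda>\<phi>. \<Sum>j\<in>UNIV. \<e> j * T (L j \<phi>))"
    by (intro continuous_map_sum) auto
qed

lift_definition dirac :: "'n::{finite,linorder} distribution \<Rightarrow> 'n distribution"
  is "\<lambda>T \<phi>. - (\<Sum>j\<in>UNIV. \<e> j * T (test_partial j \<phi>))"
proof -
  fix T :: "'n test_fun \<Rightarrow> 'n clifford"
  assume T: "linear T \<and> continuous_map test_topology euclidean T"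
  note compose =
    clifford_mult_compose[where L = test_partial, OF T linear_test_partial continuous_test_partial]
  from linear_compose_neg[OF conjunct1[OF compose]] continuous_map_minus[OF conjunct2[OF compose]]
  show "linear (\<lambda>\<phi>. - (\<Sum>j\<in>UNIV. \<e> j * T (test_partial j \<phi>))) \<and>
      continuous_map test_topology euclidean (\<lambda>\<phi>. - (\<Sum>j\<in>UNIV. \<e> j * T (test_partial j \<phi>)))"
    by (rule conjI)
qed

lift_definition vec_mult :: "'n::{finite,linorder} distribution \<Rightarrow> 'n distribution"
  is "\<lambda>T \<phi>. \<Sum>j\<in>UNIV. \<e> j * T (test_coord_mult j \<phi>)"
  by (rule clifford_mult_compose[OF _ linear_test_coord_mult continuous_test_coord_mult])

definition cl_vec :: "real ^ 'n::finite \<Rightarrow> 'n clifford"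
  where "cl_vec x = (\<Sum>j\<in>UNIV. (x $ j) *\<^sub>R \<e> j)"

text \<open>At the origin, where the direction is undefined, this returns 0. The value there is
  irrelevant: it does not affect the correspondence between \<open>\<phi>\<close> and \<open>\<omega>\<phi>\<close>.\<close>

definition omega :: "real ^ 'n::finite \<Rightarrow> 'n clifford"
  where "omega x = (1 / norm x) *\<^sub>R cl_vec x"

typedef 'n omega_fun =
  "range (\<lambda>(\<phi> :: 'n::finite test_fun) x. test_apply \<phi> x *\<^sub>R omega x)"
  morphisms omega_apply Omega_fun
  by blast

setup_lifting type_definition_omega_fun

lift_definition omega_mult :: "'n::finite test_fun \<Rightarrow> 'n omega_fun"
  is "\<lambda>\<phi> x. test_apply \<phi> x *\<^sub>R omega x"
  by blast

lemma omega_range_lincomb: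
  fixes f g :: "real ^ 'n::finite \<Rightarrow> 'n clifford"
  assumes "f \<in> range (\<lambda>\<phi> x. test_apply \<phi> x *\<^sub>R omega x)"
    "g \<in> range (\<lambda>\<phi> x. test_apply \<phi> x *\<^sub>R omega x)"
  shows "(\<lambda>x. a *\<^sub>R f x + b *\<^sub>R g x) \<in> range (\<lambda>\<phi> x. test_apply \<phi> x *\<^sub>R omega x)"
proof -
  obtain \<phi> \<psi> where "f = (\<lambda>x. test_apply \<phi> x *\<^sub>R omega x)" "g = (\<lambda>x. test_apply \<psi> x *\<^sub>R omega x)"
    using assms by blast
  then have "(\<lambda>x. a *\<^sub>R f x + b *\<^sub>R g x) =
      (\<lambda>x. test_apply (a *\<^sub>R \<phi> + b *\<^sub>R \<psi>) x *\<^sub>R omega x)"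
    by (simp add: plus_test_fun.rep_eq scaleR_test_fun.rep_eq scaleR_add_left)
  then show ?thesis by blast
qed

instantiation omega_fun :: (finite) real_vector
begin
lift_definition zero_omega_fun :: "'a omega_fun" is "\<lambda>x. 0"
  by (rule image_eqI[of _ _ 0]) (simp_all add: zero_test_fun.rep_eq)
lift_definition plus_omega_fun :: "'a omega_fun \<Rightarrow> 'a omega_fun \<Rightarrow> 'a omega_fun"
  is "\<lambda>f g x. f x + g x"
  using omega_range_lincomb[where a = 1 and b = 1] by simp
lift_definition minus_omega_fun :: "'a omega_fun \<Rightarrow> 'a omega_fun \<Rightarrow> 'a omega_fun"
  is "\<lambda>f g x. f x - g x"
  using omega_range_lincomb[where a = 1 and b = "-1"] by simp
lift_definition uminus_omega_fun :: "'a omega_fun \<Rightarrow> 'a omega_fun" is "\<lambda>f x. - f x"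
  using omega_range_lincomb[where a = "-1" and b = 0] by simp
lift_definition scaleR_omega_fun :: "real \<Rightarrow> 'a omega_fun \<Rightarrow> 'a omega_fun"
  is "\<lambda>c f x. c *\<^sub>R f x"
  using omega_range_lincomb[where b = 0] by simp
instance
  by standard (transfer; simp add: algebra_simps)+
end

lemma linear_omega_mult: "linear omega_mult"
  by (rule linearI; transfer)
    (simp_all add: plus_test_fun.rep_eq scaleR_test_fun.rep_eq scaleR_add_left)

lemma omega_nonzero: "x \<noteq> 0 \<Longrightarrow> omega x \<noteq> 0"
proof
  assume x: "x \<noteq> 0" "omega x = 0"
  have "x $ i = inner (cl_vec x) (\<e> i)" for i
    by (simp add: cl_vec_def inner_sum_left cl_gen_def inner_blade if_distrib cong: if_cong)
  moreover have "cl_vec x = 0" using x by (simp add: omega_def)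
  ultimately show False using x by (simp add: vec_eq_iff)
qed

lemma bij_omega_mult: "bij (omega_mult :: 'n::finite test_fun \<Rightarrow> 'n omega_fun)"
proof (rule bijI)
  show "surj (omega_mult :: 'n test_fun \<Rightarrow> 'n omega_fun)"
    unfolding surj_def by transfer blast
  show "inj (omega_mult :: 'n test_fun \<Rightarrow> 'n omega_fun)"
  proof (rule injI)
    fix \<phi> \<psi> :: "'n test_fun"
    assume "omega_mult \<phi> = omega_mult \<psi>"
    have eq: "test_apply \<phi> x = test_apply \<psi> x" if "x \<noteq> 0" for x
    proof -
      have "omega_apply (omega_mult \<phi>) x = omega_apply (omega_mult \<psi>) x"
        using \<open>omega_mult \<phi> = omega_mult \<psi>\<close> by simp
      then show ?thesis using omega_nonzero[OF that] by (simp add: omega_mult.rep_eq)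
    qed
    have cont: "(test_apply \<phi> \<longlongrightarrow> test_apply \<phi> 0) (at 0)" for \<phi> :: "'n test_fun"
      using test_apply[of \<phi>] smooth_differentiable differentiable_imp_continuous_within continuous_within
      by blast
    have "(test_apply \<psi> \<longlongrightarrow> test_apply \<phi> 0) (at 0)"
      using cont[of \<phi>] by (rule Lim_transform_eventually) (auto simp: eventually_at_filter eq)
    then have "test_apply \<phi> 0 = test_apply \<psi> 0"
      using cont[of \<psi>] tendsto_unique by (metis at_neq_bot)
    with eq have "test_apply \<phi> x = test_apply \<psi> x" for x by (cases "x = 0") simp_all
    then show "\<phi> = \<psi>" by (simp add: fun_eq_iff flip: test_apply_inject)
  qed
qed

definition omega_topology :: "'n::finite omega_fun topology"
  where "omega_topology = topology (\<lambda>U. openin test_topology (omega_mult -` U))"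

lemma openin_omega_topology: "openin omega_topology U \<longleftrightarrow> openin test_topology (omega_mult -` U)"
  for U :: "'n::finite omega_fun set"
proof -
  have "istopology (\<lambda>U :: 'n omega_fun set. openin test_topology (omega_mult -` U))"
    unfolding istopology_def by (auto simp: vimage_Union)
  then show ?thesis unfolding omega_topology_def by (simp add: topology_inverse')
qed

lemma topspace_omega_topology [simp]: "topspace omega_topology = UNIV"
proof -
  have "openin omega_topology UNIV"
    using openin_topspace[of test_topology] unfolding openin_omega_topology by simp
  from openin_subset[OF this] show ?thesis by auto
qed

typedef 'n signumdistribution = "{S :: 'n::finite omega_fun \<Rightarrow> 'n clifford.
    linear S \<and> continuous_map omega_topology euclidean S}"
  morphisms signum_apply Signumdistribution
  by (rule exI[of _ "\<lambda>_. 0"]) (simp add: linear_zero)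

setup_lifting type_definition_signumdistribution

instantiation signumdistribution :: (finite) real_vector
begin
lift_definition zero_signumdistribution :: "'a signumdistribution" is "\<lambda>_. 0"
  by (simp add: linear_zero)
lift_definition plus_signumdistribution ::
  "'a signumdistribution \<Rightarrow> 'a signumdistribution \<Rightarrow> 'a signumdistribution"
  is "\<lambda>S T \<psi>. S \<psi> + T \<psi>" by (simp add: linear_compose_add continuous_map_add)
lift_definition minus_signumdistribution ::
  "'a signumdistribution \<Rightarrow> 'a signumdistribution \<Rightarrow> 'a signumdistribution"
  is "\<lambda>S T \<psi>. S \<psi> - T \<psi>" by (simp add: linear_compose_sub continuous_map_diff)
lift_definition uminus_signumdistribution :: "'a signumdistribution \<Rightarrow> 'a signumdistribution"
  is "\<lambda>T \<psi>. - T \<psi>" by (simp add: linear_compose_neg)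
lift_definition scaleR_signumdistribution ::
  "real \<Rightarrow> 'a signumdistribution \<Rightarrow> 'a signumdistribution"
  is "\<lambda>r T \<psi>. r *\<^sub>R T \<psi>" by (simp add: linear_compose_scale_right continuous_map_scale)
instance
  by standard (transfer; simp add: algebra_simps)+
end

text \<open>The signumdistribution S with \<open>\<langle>S, \<omega>\<phi>\<rangle> = \<langle>T, \<phi>\<rangle>\<close> for all test functions \<open>\<phi>\<close>.\<close>

lift_definition transport :: "'n::finite distribution \<Rightarrow> 'n signumdistribution"
  is "\<lambda>T \<psi>. T (inv omega_mult \<psi>)"
proof
  fix T :: "'n test_fun \<Rightarrow> 'n clifford"
  assume T: "linear T \<and> continuous_map test_topology euclidean T"
  have inv: "inv omega_mult (omega_mult \<phi>) = \<phi>" for \<phi> :: "'n test_fun"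
    by (simp add: bij_is_inj bij_omega_mult)
  have "linear (inv omega_mult :: 'n omega_fun \<Rightarrow> 'n test_fun)"
  proof (rule linearI)
    fix f g :: "'n omega_fun" and c
    obtain \<phi> \<psi> where [simp]: "f = omega_mult \<phi>" "g = omega_mult \<psi>"
      by (meson bij_omega_mult bij_pointE)
    show "inv omega_mult (f + g) = inv omega_mult f + inv omega_mult g"
      by (simp add: inv flip: linear_add[OF linear_omega_mult])
    show "inv omega_mult (c *\<^sub>R f) = c *\<^sub>R inv omega_mult f"
      by (simp add: inv flip: linear_cmul[OF linear_omega_mult])
  qed
  then show "linear (\<lambda>\<psi>. T (inv omega_mult \<psi>))"
    using T linear_compose[of "inv omega_mult" T] by (simp add: o_def)
  have "continuous_map omega_topology test_topology (inv omega_mult :: 'n omega_fun \<Rightarrow> 'n test_fun)"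
    unfolding continuous_map by (auto simp: openin_omega_topology vimage_def inv)
  then show "continuous_map omega_topology euclidean (\<lambda>\<psi>. T (inv omega_mult \<psi>))"
    using T continuous_map_compose[of omega_topology test_topology "inv omega_mult" euclidean T]
    by (simp add: o_def)
qed

lemma signum_apply_transport: "signum_apply (transport T) (omega_mult \<phi>) = dist_apply T \<phi>"
  by transfer (simp add: bij_is_inj bij_omega_mult)

definition radial_coeff :: "nat \<Rightarrow> nat \<Rightarrow> real"
  where "radial_coeff m k = (-1) ^ k / (2 ^ k * fact k) * (\<Prod>i=1..k. real m + 2 * real i - 1)"

text \<open>The distributions \<open>\<partial>\<^sub>r\<close>^(2k) \<open>\<delta>\<close> and (\<open>\<omega> \<partial>\<^sub>r\<close>^(2k+1)) \<open>\<delta>\<close>.\<close>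

definition dr_even_delta :: "nat \<Rightarrow> 'n::{finite,linorder} distribution"
  where "dr_even_delta k = radial_coeff CARD('n) k *\<^sub>R (dirac ^^ (2 * k)) delta"

definition omega_dr_odd_delta :: "nat \<Rightarrow> 'n::{finite,linorder} distribution"
  where "omega_dr_odd_delta k = radial_coeff CARD('n) k *\<^sub>R (dirac ^^ (2 * k + 1)) delta"

text \<open>The signumdistributions \<open>\<omega> \<partial>\<^sub>r\<close>^(2k) \<open>\<delta>\<close> and \<open>\<partial>\<^sub>r\<close>^(2k+1) \<open>\<delta>\<close>.\<close>

definition omega_dr_even_delta :: "nat \<Rightarrow> 'n::{finite,linorder} signumdistribution"
  where "omega_dr_even_delta k = - transport (dr_even_delta k)"

definition dr_odd_delta :: "nat \<Rightarrow> 'n::{finite,linorder} signumdistribution"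
  where "dr_odd_delta k = transport (omega_dr_odd_delta k)"

definition r_action :: "'n::{finite,linorder} distribution \<Rightarrow> 'n signumdistribution"
  where "r_action T = transport (vec_mult T)"

text \<open>This action is only meaningful on the two families of distributions above. It is well defined
  there because their members are pairwise distinct: the nonzero multiples of
  \<open>dirac ^^ n\<close> applied to \<open>delta\<close> have different orders for different n.\<close>

definition partial_r :: "'n::{finite,linorder} distribution \<Rightarrow> 'n signumdistribution"
  where "partial_r T = (THE S.
    (\<exists>k. T = dr_even_delta k \<and> S = transport (omega_dr_odd_delta k)) \<or>
    (\<exists>k. T = omega_dr_odd_delta k \<and> S = - transport (dr_even_delta (k + 1))))"

end

theory Submission
  imports Defs
begin

text \<open>
  Write \<open>\<partial>\<close> for the Dirac operator, \<open>x\<close> for left multiplication by the vector variable, \<open>m\<close> for the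
  dimension, and \<open>P\<^sub>n = \<partial>\<^sup>n \<delta>\<close>. All distributions in the theorem are multiples of the \<open>P\<^sub>n\<close>, so the
  action of \<open>r\<close> is known once \<open>x P\<^sub>n\<close> is. Since \<open>\<partial>\<^sup>2\<close> is minus the Laplacian (\<open>dirac_dirac\<close>), hence a
  scalar operator, the Leibniz rule gives \<open>x \<partial>\<^sup>2 = \<partial>\<^sup>2 x + 2 \<partial>\<close> (\<open>vec_mult_dirac_dirac\<close>). Starting
  from \<open>x P\<^sub>0 = 0\<close> and \<open>x P\<^sub>1 = m P\<^sub>0\<close>, steps of two yield \<open>x P\<^sub>n = c\<^sub>n P\<^bsub>n-1\<^esub>\<close>, where \<open>c\<^sub>n\<close> is \<open>n\<close> for
  even \<open>n\<close> and \<open>m + n - 1\<close> for odd \<open>n\<close> (\<open>vec_mult_dirac_pow_delta\<close>). For odd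
  \<open>n\<close> this is the first formula for \<open>r\<close>; for even \<open>n\<close> the ratio of consecutive normalising
  coefficients (\<open>radial_coeff_Suc\<close>) turns it into the second.

  The two formulas for the radial derivative restate how it is defined on the two families, provided
  the definition is unambiguous. Because \<open>c\<^sub>n\<close> vanishes only for \<open>n = 0\<close>, the power \<open>x\<^sup>k\<close> sends \<open>P\<^sub>k\<close>
  to a nonzero multiple of \<open>\<delta>\<close> and kills \<open>P\<^sub>n\<close> for \<open>n < k\<close>. So nonzero multiples of \<open>P\<^sub>n\<close> and \<open>P\<^sub>k\<close>
  with \<open>n < k\<close> can only agree if \<open>\<delta> = 0\<close>, and were \<open>\<delta>\<close> zero, every candidate value would be zero
  too. Either way the value is unique (\<open>partial_r_unique\<close>).
\<close>

section \<open>Symmetry of second partial derivatives\<close>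

lemma smooth_has_real_derivative_along:
  assumes "smooth f"
  shows "((\<lambda>s. f (y + s *\<^sub>R axis i 1)) has_real_derivative
    partial_deriv i f (y + s *\<^sub>R axis i 1)) (at s)"
proof -
  obtain F where F: "(f has_derivative F) (at (y + s *\<^sub>R axis i 1))"
    using smooth_differentiable[OF assms] by (auto simp: differentiable_def)
  have "((\<lambda>s. f (y + s *\<^sub>R axis i 1)) has_derivative (\<lambda>h. F (h *\<^sub>R axis i 1))) (at s)"
    by (rule has_derivative_compose[where g = f]) (use F in \<open>auto intro!: derivative_eq_intros\<close>)
  moreover have "F (h *\<^sub>R axis i 1) = F (axis i 1) * h" for h
    using has_derivative_linear[OF F] by (simp add: linear_cmul)
  ultimately show ?thesis by (simp add: has_field_derivative_def partial_deriv_eq[OF F])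
qed

text \<open>Applying the mean value theorem in direction i and then in direction j. The left-hand side is
  symmetric in i and j while the right-hand side is a mixed derivative near x, which is what forces
  mixed derivatives to commute.\<close>

lemma second_difference_mean_value:
  fixes x :: "real ^ 'n::finite"
  assumes f: "smooth f" and t: "t > 0"
  shows "\<exists>p. dist p x \<le> 2 * t \<and>
    f (x + t *\<^sub>R axis i 1 + t *\<^sub>R axis j 1) - f (x + t *\<^sub>R axis i 1)
      - f (x + t *\<^sub>R axis j 1) + f x = t * (t * partial_deriv j (partial_deriv i f) p)"
proof -
  define u v :: "real ^ 'n" where "u = axis i 1" and "v = axis j 1"
  define g where "g s = f (x + t *\<^sub>R v + s *\<^sub>R u) - f (x + s *\<^sub>R u)" for s
  define g' where "g' s = partial_deriv i f (x + t *\<^sub>R v + s *\<^sub>R u) - partial_deriv i f (x + s *\<^sub>R u)"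
    for s
  have "DERIV g s :> g' s" for s
    unfolding g_def g'_def u_def by (intro DERIV_diff smooth_has_real_derivative_along f)
  from MVT2[OF t this] obtain \<sigma> where \<sigma>: "0 < \<sigma>" "\<sigma> < t" "g t - g 0 = t * g' \<sigma>" by auto
  define h where "h s = partial_deriv i f (x + \<sigma> *\<^sub>R u + s *\<^sub>R v)" for s
  have "DERIV h s :> partial_deriv j (partial_deriv i f) (x + \<sigma> *\<^sub>R u + s *\<^sub>R v)" for s
    unfolding h_def v_def by (intro smooth_has_real_derivative_along smooth_partial f)
  from MVT2[OF t this] obtain \<tau> where \<tau>: "0 < \<tau>" "\<tau> < t"
    "h t - h 0 = t * partial_deriv j (partial_deriv i f) (x + \<sigma> *\<^sub>R u + \<tau> *\<^sub>R v)" by auto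
  have "g' \<sigma> = h t - h 0" by (simp add: g'_def h_def add_ac)
  with \<sigma>(3) \<tau>(3) have "g t - g 0 = t * (t * partial_deriv j (partial_deriv i f) (x + \<sigma> *\<^sub>R u + \<tau> *\<^sub>R v))"
    by simp
  moreover have "dist (x + \<sigma> *\<^sub>R u + \<tau> *\<^sub>R v) x \<le> 2 * t"
  proof -
    have "norm (\<sigma> *\<^sub>R u + \<tau> *\<^sub>R v) \<le> norm (\<sigma> *\<^sub>R u) + norm (\<tau> *\<^sub>R v)" by (rule norm_triangle_ineq)
    also have "\<dots> = \<sigma> + \<tau>" using \<sigma> \<tau> by (simp add: u_def v_def norm_axis_1)
    finally show ?thesis using \<sigma> \<tau> by (simp add: dist_norm add.assoc)
  qed
  ultimately show ?thesis
    by (intro exI[of _ "x + \<sigma> *\<^sub>R u + \<tau> *\<^sub>R v"]) (simp add: g_def u_def v_def add_ac)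
qed

text \<open>If the two mixed derivatives differed at x, they would by continuity also differ at any two points
  close enough to x; but the same second difference quotient is a value of each of them near x.\<close>

lemma partial_deriv_commute:
  assumes f: "smooth f"
  shows "partial_deriv i (partial_deriv j f) = partial_deriv j (partial_deriv i f)"
proof
  fix x
  let ?A = "partial_deriv i (partial_deriv j f)" and ?B = "partial_deriv j (partial_deriv i f)"
  have cont: "isCont ?A x" "isCont ?B x"
    using f by (auto intro!: differentiable_imp_continuous_within smooth_differentiable smooth_partial)
  show "?A x = ?B x"
  proof (rule ccontr)
    assume "?A x \<noteq> ?B x"
    then have e: "\<bar>?A x - ?B x\<bar> / 2 > 0" (is "?e > 0") by simp
    obtain d1 where d1: "d1 > 0" "\<And>y. dist y x < d1 \<Longrightarrow> dist (?A y) (?A x) < ?e"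
      using cont(1) e unfolding continuous_at_eps_delta by blast
    obtain d2 where d2: "d2 > 0" "\<And>y. dist y x < d2 \<Longrightarrow> dist (?B y) (?B x) < ?e"
      using cont(2) e unfolding continuous_at_eps_delta by blast
    define t where "t = min d1 d2 / 4"
    have t: "t > 0" "2 * t < d1" "2 * t < d2" using d1(1) d2(1) by (auto simp: t_def)
    obtain p where p: "dist p x \<le> 2 * t"
      "f (x + t *\<^sub>R axis i 1 + t *\<^sub>R axis j 1) - f (x + t *\<^sub>R axis i 1)
        - f (x + t *\<^sub>R axis j 1) + f x = t * (t * ?B p)"
      using second_difference_mean_value[OF f t(1)] by blast
    obtain q where q: "dist q x \<le> 2 * t"
      "f (x + t *\<^sub>R axis j 1 + t *\<^sub>R axis i 1) - f (x + t *\<^sub>R axis j 1)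
        - f (x + t *\<^sub>R axis i 1) + f x = t * (t * ?A q)"
      using second_difference_mean_value[OF f t(1)] by blast
    have "t * (t * ?A q) = t * (t * ?B p)"
      unfolding p(2)[symmetric] q(2)[symmetric] by (simp add: add_ac)
    then have "?A q = ?B p" using t(1) by simp
    moreover have "dist (?A q) (?A x) < ?e" using d1(2) q(1) t(2) by simp
    moreover have "dist (?B p) (?B x) < ?e" using d2(2) p(1) t(3) by simp
    ultimately show False by (simp add: dist_real_def abs_if split: if_splits)
  qed
qed

lemma test_partial_commute: "test_partial i (test_partial j \<phi>) = test_partial j (test_partial i \<phi>)"
  by transfer (simp add: partial_deriv_commute)

lemma test_partial_coord_mult:
  "test_partial i (test_coord_mult j \<phi>) =
    test_coord_mult j (test_partial i \<phi>) + (if i = j then \<phi> else 0)"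
proof (cases "i = j")
  case True
  then show ?thesis
    by simp (transfer, simp add: fun_eq_iff partial_deriv_coord smooth_differentiable)
next
  case False
  then show ?thesis
    by simp (transfer, simp add: fun_eq_iff partial_deriv_coord smooth_differentiable)
qed

section \<open>The Dirac operator and multiplication by the vector variable\<close>

lemma distribution_eqI: "(\<And>\<phi>. dist_apply S \<phi> = dist_apply T \<phi>) \<Longrightarrow> S = T"
  by (simp add: fun_eq_iff flip: dist_apply_inject)

lemma linear_dist_apply: "linear (dist_apply T)"
  using dist_apply[of T] by simp

lemma linear_dirac: "linear dirac"
  by (rule linearI; rule distribution_eqI)
    (simp_all add: dirac.rep_eq plus_distribution.rep_eq scaleR_distribution.rep_eq
      algebra_simps sum.distrib scaleR_sum_right)

lemma linear_vec_mult: "linear vec_mult"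
  by (rule linearI; rule distribution_eqI)
    (simp_all add: vec_mult.rep_eq plus_distribution.rep_eq scaleR_distribution.rep_eq
      algebra_simps sum.distrib scaleR_sum_right)

lemma linear_transport: "linear transport"
  by (rule linearI; transfer) simp_all

text \<open>Adding the sum to itself with i and j exchanged leaves the anticommutators
  \<open>\<e> i * \<e> j + \<e> j * \<e> i\<close>, which are -2 on the diagonal and 0 off it.\<close>

lemma sum_cl_gen_symmetric:
  fixes S :: "'n::{finite,linorder} \<Rightarrow> 'n \<Rightarrow> 'n clifford"
  assumes S: "\<And>i j. S i j = S j i"
  shows "(\<Sum>i\<in>UNIV. \<Sum>j\<in>UNIV. \<e> i * (\<e> j * S i j)) = - (\<Sum>i\<in>UNIV. S i i)"
proof -
  let ?L = "\<Sum>i\<in>UNIV. \<Sum>j\<in>UNIV. \<e> i * (\<e> j * S i j)"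
  have anti: "\<e> i * (\<e> j * S i j) + \<e> j * (\<e> i * S i j) = (if i = j then - S i i - S i i else 0)" for i j
    using cl_gen_anticommute[of i j]
    by (cases "i = j") (simp_all add: cl_gen_square mult.assoc[symmetric] mult_2 distrib_right[symmetric])
  have "?L = (\<Sum>i\<in>UNIV. \<Sum>j\<in>UNIV. \<e> j * (\<e> i * S i j))"
    by (subst sum.swap) (simp add: S)
  then have "?L + ?L = (\<Sum>i\<in>UNIV. \<Sum>j\<in>UNIV. \<e> i * (\<e> j * S i j) + \<e> j * (\<e> i * S i j))"
    by (simp add: sum.distrib)
  also have "\<dots> = - (\<Sum>i\<in>UNIV. S i i) - (\<Sum>i\<in>UNIV. S i i)"
    by (simp add: anti sum_subtractf sum_negf)
  finally have "2 *\<^sub>R ?L = 2 *\<^sub>R (- (\<Sum>i\<in>UNIV. S i i))" by (simp add: scaleR_2)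
  then show ?thesis by (rule scaleR_left_imp_eq[rotated]) simp
qed

definition test_laplace :: "'n::finite test_fun \<Rightarrow> 'n test_fun"
  where "test_laplace \<phi> = (\<Sum>i\<in>UNIV. test_partial i (test_partial i \<phi>))"

lemma dirac_dirac: "dist_apply (dirac (dirac T)) \<phi> = - dist_apply T (test_laplace \<phi>)"
proof -
  have "dist_apply (dirac (dirac T)) \<phi> =
      (\<Sum>i\<in>UNIV. \<Sum>j\<in>UNIV. \<e> i * (\<e> j * dist_apply T (test_partial j (test_partial i \<phi>))))"
    by (simp add: dirac.rep_eq sum_distrib_left sum_negf)
  also have "\<dots> = - dist_apply T (test_laplace \<phi>)"
    by (subst sum_cl_gen_symmetric)
      (simp_all add: test_partial_commute test_laplace_def linear_sum[OF linear_dist_apply])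
  finally show ?thesis .
qed

lemma test_laplace_coord_mult:
  "test_laplace (test_coord_mult j \<phi>) =
    test_coord_mult j (test_laplace \<phi>) + 2 *\<^sub>R test_partial j \<phi>"
proof -
  have "test_partial i (test_partial i (test_coord_mult j \<phi>)) =
      test_coord_mult j (test_partial i (test_partial i \<phi>)) +
      (if i = j then 2 *\<^sub>R test_partial j \<phi> else 0)" for i
    by (simp add: test_partial_coord_mult linear_add[OF linear_test_partial]
        linear_0[OF linear_test_partial] scaleR_2)
  then show ?thesis
    by (simp add: test_laplace_def sum.distrib linear_sum[OF linear_test_coord_mult])
qed

text \<open>The Laplacian is a scalar operator and passes through the generators in \<open>vec_mult\<close>, so the
  commutator comes only from \<open>test_laplace_coord_mult\<close>; working with \<open>dirac\<close> once instead of
  twice would produce the Euler operator.\<close>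

lemma vec_mult_dirac_dirac:
  "vec_mult (dirac (dirac T)) = dirac (dirac (vec_mult T)) + 2 *\<^sub>R dirac T"
proof (rule distribution_eqI)
  fix \<phi>
  have "dist_apply (vec_mult (dirac (dirac T))) \<phi> =
      - (\<Sum>j\<in>UNIV. \<e> j * dist_apply T (test_laplace (test_coord_mult j \<phi>)))"
    by (simp only: vec_mult.rep_eq dirac_dirac) (simp add: sum_negf)
  also have "\<dots> = - (\<Sum>j\<in>UNIV. \<e> j * dist_apply T (test_coord_mult j (test_laplace \<phi>)))
      - 2 *\<^sub>R (\<Sum>j\<in>UNIV. \<e> j * dist_apply T (test_partial j \<phi>))"
    by (simp add: test_laplace_coord_mult linear_add[OF linear_dist_apply]
        linear_cmul[OF linear_dist_apply] distrib_left sum.distrib scaleR_sum_right)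
  also have "\<dots> = dist_apply (dirac (dirac (vec_mult T)) + 2 *\<^sub>R dirac T) \<phi>"
    by (simp only: plus_distribution.rep_eq scaleR_distribution.rep_eq dirac_dirac)
      (simp add: vec_mult.rep_eq dirac.rep_eq)
  finally show "dist_apply (vec_mult (dirac (dirac T))) \<phi> =
      dist_apply (dirac (dirac (vec_mult T)) + 2 *\<^sub>R dirac T) \<phi>" .
qed

lemma vec_mult_delta: "vec_mult delta = 0"
  by (rule distribution_eqI)
    (simp add: vec_mult.rep_eq delta.rep_eq zero_distribution.rep_eq test_coord_mult.rep_eq)

lemma vec_mult_dirac_delta:
  "vec_mult (dirac delta) = real CARD('n) *\<^sub>R (delta :: 'n::{finite,linorder} distribution)"
proof (rule distribution_eqI)
  fix \<phi> :: "'n test_fun"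
  have leibniz: "dist_apply delta (test_partial i (test_coord_mult j \<phi>)) =
      (if i = j then dist_apply delta \<phi> else 0)" for i j
    by (simp add: test_partial_coord_mult delta.rep_eq plus_test_fun.rep_eq test_coord_mult.rep_eq
        zero_test_fun.rep_eq)
  have "dist_apply (vec_mult (dirac delta)) \<phi> =
      (\<Sum>j\<in>UNIV. - (\<e> j * (\<e> j * dist_apply delta \<phi>)))"
    unfolding vec_mult.rep_eq dirac.rep_eq leibniz
    by (simp add: if_distrib cong: if_cong)
  also have "\<dots> = dist_apply (real CARD('n) *\<^sub>R delta) \<phi>"
    by (simp add: cl_gen_square scaleR_distribution.rep_eq scaleR_conv_of_real flip: mult.assoc)
  finally show "dist_apply (vec_mult (dirac delta)) \<phi> = dist_apply (real CARD('n) *\<^sub>R delta) \<phi>" .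
qed

text \<open>The value 0 at n = 0 lets \<open>vec_mult_dirac_pow_delta\<close> cover \<open>vec_mult_delta\<close>, where the truncated
  \<open>n - 1\<close> is also 0.\<close>

definition lowering_coeff :: "nat \<Rightarrow> nat \<Rightarrow> real"
  where "lowering_coeff m n = (if even n then real n else real m + real n - 1)"

lemma vec_mult_dirac_pow_delta:
  "vec_mult ((dirac ^^ n) delta) =
    lowering_coeff CARD('n) n *\<^sub>R (dirac ^^ (n - 1)) (delta :: 'n::{finite,linorder} distribution)"
proof (induction n rule: induct_nat_012)
  case 0
  show ?case by (simp add: vec_mult_delta lowering_coeff_def)
next
  case 1
  show ?case by (simp add: vec_mult_dirac_delta lowering_coeff_def)
next
  case (ge2 n)
  let ?P = "\<lambda>n. (dirac ^^ n) (delta :: 'n distribution)" and ?c = "lowering_coeff CARD('n)"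
  have "?c n *\<^sub>R dirac (dirac (?P (n - 1))) = ?c n *\<^sub>R ?P (Suc n)"
    by (cases n) (simp_all add: lowering_coeff_def)
  then have "vec_mult (?P (Suc (Suc n))) = (?c n + 2) *\<^sub>R ?P (Suc n)"
    using ge2.IH(1) by (simp add: vec_mult_dirac_dirac linear_cmul[OF linear_dirac] scaleR_add_left)
  moreover have "?c n + 2 = ?c (Suc (Suc n))" by (simp add: lowering_coeff_def)
  ultimately show ?case by simp
qed

section \<open>The powers of the Dirac operator applied to delta are pairwise independent\<close>

lemma linear_vec_mult_pow: "linear (vec_mult ^^ n)"
proof (induction n)
  case (Suc n)
  show ?case using linear_compose[OF Suc linear_vec_mult] by (simp only: funpow.simps(2))
qed (simp add: linear_id[unfolded id_def] id_def)

lemma vec_mult_pow_dirac_pow_delta: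
  "\<exists>c\<noteq>0. (vec_mult ^^ n) ((dirac ^^ n) delta) = c *\<^sub>R (delta :: 'n::{finite,linorder} distribution)"
proof (induction n)
  case 0
  show ?case by (rule exI[of _ 1]) simp
next
  case (Suc n)
  then obtain c where c: "c \<noteq> 0" "(vec_mult ^^ n) ((dirac ^^ n) delta) = c *\<^sub>R (delta :: 'n distribution)"
    by blast
  have "lowering_coeff CARD('n) (Suc n) \<noteq> 0"
    using zero_less_card_finite[where 'a='n] by (auto simp: lowering_coeff_def add_nonneg_eq_0_iff)
  moreover have "(vec_mult ^^ Suc n) ((dirac ^^ Suc n) delta) =
      (lowering_coeff CARD('n) (Suc n) * c) *\<^sub>R (delta :: 'n distribution)"
    unfolding funpow_Suc_right[of n vec_mult] o_apply vec_mult_dirac_pow_delta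
    by (simp add: linear_cmul[OF linear_vec_mult_pow] c(2))
  ultimately show ?case using c(1) by (metis mult_eq_0_iff)
qed

text \<open>Applying \<open>vec_mult ^^ k\<close> to both sides: the left-hand side has already been lowered to
  \<open>vec_mult delta = 0\<close> after \<open>n + 1\<close> steps, while the right-hand side becomes a nonzero multiple of
  delta.\<close>

lemma dirac_pow_delta_less_imp_delta_zero:
  assumes "n < k" "b \<noteq> 0"
    and eq: "a *\<^sub>R (dirac ^^ n) delta = b *\<^sub>R (dirac ^^ k) (delta :: 'n::{finite,linorder} distribution)"
  shows "(delta :: 'n distribution) = 0"
proof -
  have zero: "(vec_mult ^^ i) 0 = (0 :: 'n distribution)" for i
    by (rule linear_0[OF linear_vec_mult_pow])
  obtain c where "(vec_mult ^^ n) ((dirac ^^ n) delta) = c *\<^sub>R (delta :: 'n distribution)"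
    using vec_mult_pow_dirac_pow_delta by blast
  then have "(vec_mult ^^ Suc n) ((dirac ^^ n) delta) = (0 :: 'n distribution)"
    by (simp add: linear_cmul[OF linear_vec_mult] vec_mult_delta)
  moreover have "(vec_mult ^^ k) T = (vec_mult ^^ (k - Suc n)) ((vec_mult ^^ Suc n) T)"
    for T :: "'n distribution"
    using \<open>n < k\<close> by (metis Suc_leI le_add_diff_inverse2 funpow_add o_apply)
  ultimately have "(vec_mult ^^ k) ((dirac ^^ n) delta) = (0 :: 'n distribution)"
    by (simp only: zero)
  then have "(vec_mult ^^ k) (b *\<^sub>R (dirac ^^ k) delta) = (0 :: 'n distribution)"
    by (simp add: linear_cmul[OF linear_vec_mult_pow] flip: eq)
  moreover obtain d where "d \<noteq> 0" "(vec_mult ^^ k) ((dirac ^^ k) delta) = d *\<^sub>R (delta :: 'n distribution)"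
    using vec_mult_pow_dirac_pow_delta by blast
  ultimately show ?thesis using \<open>b \<noteq> 0\<close> by (simp add: linear_cmul[OF linear_vec_mult_pow])
qed

lemma dirac_pow_delta_index_unique:
  assumes "(delta :: 'n::{finite,linorder} distribution) \<noteq> 0" "a \<noteq> 0" "b \<noteq> 0"
    and "a *\<^sub>R (dirac ^^ n) delta = b *\<^sub>R (dirac ^^ k) (delta :: 'n distribution)"
  shows "n = k"
  using assms dirac_pow_delta_less_imp_delta_zero[of n k b a]
    dirac_pow_delta_less_imp_delta_zero[of k n a b] by (metis linorder_neqE_nat)

section \<open>The actions of r and of the radial derivative\<close>

lemma radial_coeff_nonzero: "m > 0 \<Longrightarrow> radial_coeff m k \<noteq> 0"
  by (auto simp: radial_coeff_def)

text \<open>This ratio of consecutive coefficients converts the factor \<open>2 * (k + 1)\<close> that \<open>vec_mult\<close> produces on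
  an even power of \<open>dirac\<close> into the factor \<open>m + 2 * k + 1\<close> of the theorem.\<close>

lemma radial_coeff_Suc:
  "2 * (real k + 1) * radial_coeff m (Suc k) = - (real m + 2 * real k + 1) * radial_coeff m k"
proof -
  define Q where "Q = (\<Prod>i=1..k. real m + 2 * real i - 1)"
  have "(\<Prod>i=1..Suc k. real m + 2 * real i - 1) = Q * (real m + 2 * real k + 1)"
    by (simp add: Q_def)
  then have Suc: "radial_coeff m (Suc k) =
      (-1) ^ Suc k / (2 * 2 ^ k * ((real k + 1) * fact k)) * (Q * (real m + 2 * real k + 1))"
    by (simp add: radial_coeff_def add.commute)
  have k: "radial_coeff m k = (-1) ^ k / (2 ^ k * fact k) * Q"
    by (simp add: radial_coeff_def Q_def)
  have "real k + 1 \<noteq> 0" by linarith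
  then show ?thesis unfolding Suc k by (simp add: divide_simps) (simp add: algebra_simps)
qed

text \<open>The description defining \<open>partial_r\<close> has at most one solution: either delta vanishes, and every
  admissible value is 0, or each member of the two families determines its family and its index.\<close>

lemma partial_r_unique:
  fixes T :: "'n::{finite,linorder} distribution"
  defines "P \<equiv> \<lambda>S. (\<exists>k. T = dr_even_delta k \<and> S = transport (omega_dr_odd_delta k)) \<or>
    (\<exists>k. T = omega_dr_odd_delta k \<and> S = - transport (dr_even_delta (k + 1)))"
  assumes S: "P S"
  shows "partial_r T = S"
proof -
  have "S' = S" if S': "P S'" for S'
  proof (cases "(delta :: 'n distribution) = 0")
    case True
    have "(dirac ^^ n) 0 = (0 :: 'n distribution)" for n
      by (induction n) (simp_all add: linear_0[OF linear_dirac])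
    with True have "dr_even_delta k = (0 :: 'n distribution)"
      "omega_dr_odd_delta k = (0 :: 'n distribution)" for k
      by (simp_all add: dr_even_delta_def omega_dr_odd_delta_def linear_0[OF linear_dirac])
    then show ?thesis using S S' by (auto simp: P_def linear_0[OF linear_transport])
  next
    case False
    note index = dirac_pow_delta_index_unique[OF False radial_coeff_nonzero radial_coeff_nonzero]
    have "i = k" if "dr_even_delta i = (dr_even_delta k :: 'n distribution)" for i k
      using index[OF _ _ that[unfolded dr_even_delta_def]] by simp
    moreover have "i = k" if "omega_dr_odd_delta i = (omega_dr_odd_delta k :: 'n distribution)" for i k
      using index[OF _ _ that[unfolded omega_dr_odd_delta_def]] by simp
    moreover have "dr_even_delta i \<noteq> (omega_dr_odd_delta k :: 'n distribution)" for i k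
    proof
      assume "dr_even_delta i = (omega_dr_odd_delta k :: 'n distribution)"
      from index[OF _ _ this[unfolded dr_even_delta_def omega_dr_odd_delta_def]]
      have "2 * i = 2 * k + 1" by simp
      then show False by presburger
    qed
    ultimately show ?thesis using S S' unfolding P_def by metis
  qed
  with S show ?thesis unfolding partial_r_def P_def by (rule the_equality)
qed

lemma r_action_omega_dr_odd_delta:
  "r_action (omega_dr_odd_delta k) =
    - (real CARD('n) + 2 * real k) *\<^sub>R (omega_dr_even_delta k :: 'n::{finite,linorder} signumdistribution)"
proof -
  have "vec_mult (omega_dr_odd_delta k) =
      (real CARD('n) + 2 * real k) *\<^sub>R (dr_even_delta k :: 'n distribution)"
    unfolding omega_dr_odd_delta_def linear_cmul[OF linear_vec_mult] vec_mult_dirac_pow_delta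
    by (simp add: dr_even_delta_def lowering_coeff_def)
  then show ?thesis
    by (simp only: r_action_def omega_dr_even_delta_def linear_cmul[OF linear_transport]
        scaleR_minus_left scaleR_minus_right minus_minus)
qed

lemma r_action_dr_even_delta:
  "r_action (dr_even_delta (Suc k)) =
    - (real CARD('n) + 2 * real k + 1) *\<^sub>R (dr_odd_delta k :: 'n::{finite,linorder} signumdistribution)"
proof -
  have "vec_mult (dr_even_delta (Suc k)) =
      (2 * (real k + 1) * radial_coeff CARD('n) (Suc k)) *\<^sub>R (dirac ^^ (2 * k + 1)) (delta :: 'n distribution)"
    unfolding dr_even_delta_def linear_cmul[OF linear_vec_mult] vec_mult_dirac_pow_delta
    by (simp add: lowering_coeff_def algebra_simps)
  then have "vec_mult (dr_even_delta (Suc k)) =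
      - (real CARD('n) + 2 * real k + 1) *\<^sub>R (omega_dr_odd_delta k :: 'n distribution)"
    by (simp only: radial_coeff_Suc omega_dr_odd_delta_def scaleR_scaleR)
  then show ?thesis
    by (simp only: r_action_def dr_odd_delta_def linear_cmul[OF linear_transport])
qed

theorem mainTheorem1:
  shows "(\<forall>k::nat. (r_action (omega_dr_odd_delta k) :: 'n::{finite,linorder} signumdistribution) =
            - (real CARD('n) + 2 * real k) *\<^sub>R omega_dr_even_delta k) \<and>
         (\<forall>k\<ge>1. (r_action (dr_even_delta k) :: 'n signumdistribution) =
            - (real CARD('n) + 2 * real k - 1) *\<^sub>R dr_odd_delta (k - 1)) \<and>
         (\<forall>k::nat. (partial_r (omega_dr_odd_delta k) :: 'n signumdistribution) =
            omega_dr_even_delta (k + 1)) \<and>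
         (\<forall>k::nat. (partial_r (dr_even_delta k) :: 'n signumdistribution) = dr_odd_delta k)"
proof (intro conjI allI impI)
  fix k :: nat
  show "(r_action (omega_dr_odd_delta k) :: 'n signumdistribution) =
      - (real CARD('n) + 2 * real k) *\<^sub>R omega_dr_even_delta k"
    by (rule r_action_omega_dr_odd_delta)
  show "(partial_r (omega_dr_odd_delta k) :: 'n signumdistribution) = omega_dr_even_delta (k + 1)"
    unfolding omega_dr_even_delta_def by (rule partial_r_unique) blast
  show "(partial_r (dr_even_delta k) :: 'n signumdistribution) = dr_odd_delta k"
    unfolding dr_odd_delta_def by (rule partial_r_unique) blast
next
  fix k :: nat
  assume "k \<ge> 1"
  then obtain l where "k = Suc l" by (cases k) auto
  then show "(r_action (dr_even_delta k) :: 'n signumdistribution) =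
      - (real CARD('n) + 2 * real k - 1) *\<^sub>R dr_odd_delta (k - 1)"
    using r_action_dr_even_delta[of l, where 'n='n] by (simp add: algebra_simps)
qed

end
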